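(* For every integer $n\ge 0$, the cop number of the $n$-dimensional Lucas cube $\Lambda_n$ is $$c(\Lambda_n)=\left\lceil\frac{\lfloor n/2\rfloor+1}{2}\right\rceil=\lfloor n/4\rfloor+1 .$$ Equivalently, for every integer $q\ge0$, $$c(\Lambda_{4q})=c(\Lambda_{4q+1})=c(\Lambda_{4q+2})=c(\Lambda_{4q+3})=q+1 .$$
   Context: For $n\ge2$, the $n$-dimensional Lucas cube $\Lambda_n$ is the graph whose vertices are all binary strings $x_1x_2\cdots x_n$ of length $n$ that do not contain two consecutive $1$'s and do not have both $x_1=1$ and $x_n=1$; two strings are adjacent iff they differ in exactly one bit (an induced subgraph of the hypercube $Q_n$). By convention $\Lambda_0=\Lambda_1=K_1$. Cops and Robbers: on a connected graph, the cops first choose initial vertices (several cops may share a vertex), then the robber chooses an initial vertex. The sides then move alternately, cops first; on the cops' turn every cop, and on the robber's turn the robber, either stays or moves to an adjacent vertex. All positions are visible to all players. The cops win if at some time a cop occupies the robber's vertex; the robber wins if he evades capture forever. The cop number $c(G)$ is the minimum number of cops that guarantees capture on $G$. *)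

theory Defs
  imports Complex_Main
begin

text \<open>A graph is given by its vertex set \<open>V\<close> and an adjacency relation \<open>E\<close>, of which only the
  restriction to \<open>V\<close> matters.\<close>

definition legal_move :: "'a set \<Rightarrow> ('a \<Rightarrow> 'a \<Rightarrow> bool) \<Rightarrow> 'a \<Rightarrow> 'a \<Rightarrow> bool" where
  "legal_move V E u v \<longleftrightarrow> u \<in> V \<and> v \<in> V \<and> (v = u \<or> E u v)"

definition robber_play :: "'a set \<Rightarrow> ('a \<Rightarrow> 'a \<Rightarrow> bool) \<Rightarrow> (nat \<Rightarrow> 'a) \<Rightarrow> bool" where
  "robber_play V E r \<longleftrightarrow> r 0 \<in> V \<and> (\<forall>t. legal_move V E (r t) (r (Suc t)))"

text \<open>The list \<open>c t\<close> holds the positions of the \<open>k\<close> cops after \<open>t\<close> moves; entry \<open>i\<close> belongs to cop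
  \<open>i\<close>, and entries may coincide.\<close>

definition cops_play ::
  "'a set \<Rightarrow> ('a \<Rightarrow> 'a \<Rightarrow> bool) \<Rightarrow> nat \<Rightarrow> (nat \<Rightarrow> 'a list) \<Rightarrow> bool" where
  "cops_play V E k c \<longleftrightarrow>
     length (c 0) = k \<and> set (c 0) \<subseteq> V \<and>
     (\<forall>t. length (c (Suc t)) = k \<and> (\<forall>i<k. legal_move V E (c t ! i) (c (Suc t) ! i)))"

text \<open>The positions are chosen in the order \<open>c 0, r 0, c 1, r 1, \<dots>\<close>. So the robber standing at
  \<open>r t\<close> faces the cops at \<open>c t\<close> after his own choice and the cops at \<open>c (Suc t)\<close> after their
  reply.\<close>

definition captured :: "(nat \<Rightarrow> 'a list) \<Rightarrow> (nat \<Rightarrow> 'a) \<Rightarrow> bool" where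
  "captured c r \<longleftrightarrow> (\<exists>t. r t \<in> set (c t) \<or> r t \<in> set (c (Suc t)))"

text \<open>A strategy of the cops maps the robber's positions so far, \<open>[r 0, \<dots>, r (t - 1)]\<close>, to the
  cops' next positions \<open>c t\<close>; in particular \<open>s []\<close> is their initial placement. The cops' own
  earlier positions need not be arguments, being determined by \<open>s\<close> and the robber's positions.\<close>

definition strategy_play :: "('a list \<Rightarrow> 'a list) \<Rightarrow> (nat \<Rightarrow> 'a) \<Rightarrow> nat \<Rightarrow> 'a list" where
  "strategy_play s r t = s (map r [0..<t])"

definition cops_win :: "'a set \<Rightarrow> ('a \<Rightarrow> 'a \<Rightarrow> bool) \<Rightarrow> nat \<Rightarrow> bool" where
  "cops_win V E k \<longleftrightarrow>
     (\<exists>s. \<forall>r. robber_play V E r \<longrightarrow>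
        cops_play V E k (strategy_play s r) \<and> captured (strategy_play s r) r)"

definition cop_number :: "'a set \<Rightarrow> ('a \<Rightarrow> 'a \<Rightarrow> bool) \<Rightarrow> nat" where
  "cop_number V E = (LEAST k. cops_win V E k)"

text \<open>Binary strings are lists of booleans, with \<open>x\<^sub>i\<close> stored at index \<open>i - 1\<close>.\<close>

definition hypercube_adj :: "bool list \<Rightarrow> bool list \<Rightarrow> bool" where
  "hypercube_adj x y \<longleftrightarrow>
     length x = length y \<and> card {i. i < length x \<and> x ! i \<noteq> y ! i} = 1"

definition lucas_vertices :: "nat \<Rightarrow> bool list set" where
  "lucas_vertices n =
     (if n < 2 then {replicate n False}
      else {x. length x = n \<and> (\<forall>i. Suc i < n \<longrightarrow> \<not> (x ! i \<and> x ! Suc i))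
               \<and> \<not> (x ! 0 \<and> x ! (n - 1))})"

text \<open>The Lucas cube is the subgraph of the hypercube induced by \<^const>\<open>lucas_vertices\<close>.\<close>

definition lucas_cop_number :: "nat \<Rightarrow> nat" where
  "lucas_cop_number n = cop_number (lucas_vertices n) hypercube_adj"

end

theory Submission
  imports Defs "HOL-Library.Disjoint_Sets"
begin

text \<open>Reading a string as the set of positions of its ones turns the Lucas cube into a family of
  finite sets closed under subsets, with largest cardinality \<open>m = n div 2\<close>. In every such family
  the cop number is \<open>m div 2 + 1\<close>.

  If \<open>2k \<le> m\<close>, the robber stays among the subsets of a member \<open>M\<close> of size \<open>m\<close>. There he has
  \<open>m + 1\<close> options per move, and a cop at \<open>C\<close> whose shadow \<open>C \<inter> M\<close> is not his position guards at
  most two of them.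

  If \<open>2k > m\<close>, let \<open>D\<^sub>j\<close> be the symmetric difference of the robber's set \<open>R\<close> and cop \<open>j\<close>'s set
  \<open>C\<^sub>j\<close>. The cops never let a \<open>|D\<^sub>j|\<close> grow and keep at most one of them odd. A robber who passes or
  flips an element of some \<open>D\<^sub>j\<close> lowers their sum. When he adds another element, each cop
  not inside \<open>R\<close> drops an element outside \<open>R\<close>, so eventually every \<open>D\<^sub>j \<subseteq> R\<close>. Then the parity
  condition gives \<open>\<Sum>|D\<^sub>j| \<ge> 2k - 1 \<ge> m\<close>, which exceeds \<open>|R|\<close> if the robber can still add an
  element; so two of the \<open>D\<^sub>j\<close> overlap, and one of these two cops can exchange a common element
  for the new one, which enlarges \<open>\<Union>D\<^sub>j\<close>. As \<open>R\<close> cannot shrink forever, the robber is caught.\<close>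

subsection \<open>Criteria for winning\<close>

definition cops_step :: "'a set \<Rightarrow> ('a \<Rightarrow> 'a \<Rightarrow> bool) \<Rightarrow> nat \<Rightarrow> 'a list \<Rightarrow> 'a list \<Rightarrow> bool" where
  "cops_step V E k c c' \<longleftrightarrow> length c' = k \<and> (\<forall>i<k. legal_move V E (c ! i) (c' ! i))"

lemma cops_step_refl: "length c = k \<Longrightarrow> set c \<subseteq> V \<Longrightarrow> cops_step V E k c c"
  by (auto simp: cops_step_def legal_move_def)

lemma cops_step_subset: "cops_step V E k c c' \<Longrightarrow> set c' \<subseteq> V"
  by (auto simp: cops_step_def legal_move_def in_set_conv_nth)

lemma cops_play_iff:
  "cops_play V E k c \<longleftrightarrow>
     length (c 0) = k \<and> set (c 0) \<subseteq> V \<and> (\<forall>t. cops_step V E k (c t) (c (Suc t)))"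
  by (simp add: cops_play_def cops_step_def)

lemma cops_playD:
  assumes "cops_play V E k c"
  shows "length (c t) = k" "set (c t) \<subseteq> V"
proof -
  show "length (c t) = k"
    using assms by (cases t) (simp_all add: cops_play_def)
  show "set (c t) \<subseteq> V"
    using assms cops_step_subset[of V E k "c (t - 1)" "c t"]
    by (cases t) (simp_all add: cops_play_iff)
qed

text \<open>The last argument is the robber's history, latest position first.\<close>

fun replay ::
  "('a \<Rightarrow> 'a list) \<Rightarrow> ('a \<Rightarrow> 'a list \<Rightarrow> 'a \<Rightarrow> 'a list) \<Rightarrow> 'a list \<Rightarrow> 'a list \<Rightarrow> 'a list" where
  "replay f0 f c0 [] = c0"
| "replay f0 f c0 [r] = f0 r"
| "replay f0 f c0 (r' # r # h) = f r (replay f0 f c0 (r # h)) r'"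

text \<open>\<open>P r c\<close> is read with the cops at \<open>c\<close> and the robber at
  \<open>r\<close> about to move; the cops get one move after his first choice before it has to
  hold. A robber never caught would produce an infinite descent in \<open>W\<close>.\<close>

lemma cops_winI:
  assumes c0: "length c0 = k" "set c0 \<subseteq> V"
    and wf: "wf W"
    and start: "\<And>r. r \<in> V \<Longrightarrow> \<exists>c. cops_step V E k c0 c \<and> (r \<in> set c0 \<or> r \<in> set c \<or> P r c)"
    and reply: "\<And>r c r'. \<lbrakk>P r c; length c = k; legal_move V E r r'; r' \<notin> set c\<rbrakk> \<Longrightarrow>
      \<exists>c'. cops_step V E k c c' \<and> (r' \<in> set c' \<or> P r' c' \<and> ((r', c'), (r, c)) \<in> W)"
  shows "cops_win V E k"
proof -
  obtain f0 where f0: "\<And>r. r \<in> V \<Longrightarrow>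
      cops_step V E k c0 (f0 r) \<and> (r \<in> set c0 \<or> r \<in> set (f0 r) \<or> P r (f0 r))"
    using start by metis
  \<comment> \<open>A legal cop move is demanded unconditionally, because a winning strategy must
    play legally against every robber, even after capture.\<close>
  define good where "good r c r' c' \<longleftrightarrow> cops_step V E k c c' \<and>
      (P r c \<and> legal_move V E r r' \<and> r' \<notin> set c \<longrightarrow>
         r' \<in> set c' \<or> P r' c' \<and> ((r', c'), (r, c)) \<in> W)" for r c r' c'
  define f where "f r c r' = (SOME c'. good r c r' c')" for r c r'
  have good_ex: "\<exists>c'. good r c r' c'" if "length c = k" "set c \<subseteq> V" for r c r'
    using reply[of r c r'] cops_step_refl[OF that] that unfolding good_def by blast
  have f: "good r c r' (f r c r')" if "length c = k" "set c \<subseteq> V" for r c r'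
    unfolding f_def by (rule someI_ex) (rule good_ex[OF that])
  define s where "s h = replay f0 f c0 (rev h)" for h
  have "cops_play V E k (strategy_play s r) \<and> captured (strategy_play s r) r"
    if play: "robber_play V E r" for r
  proof -
    define c where "c = strategy_play s r"
    have legal: "legal_move V E (r t) (r (Suc t))" and rV: "r t \<in> V" for t
      using play by (auto simp: robber_play_def legal_move_def)
    have c_0: "c 0 = c0" and c_1: "c (Suc 0) = f0 (r 0)"
      and c_Suc: "c (Suc (Suc t)) = f (r t) (c (Suc t)) (r (Suc t))" for t
      by (simp_all add: c_def strategy_play_def s_def)
    have valid: "length (c t) = k \<and> set (c t) \<subseteq> V \<and> cops_step V E k (c t) (c (Suc t))" for t
    proof (induction t)
      case 0
      show ?case using c0 f0 rV by (simp add: c_0 c_1)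
    next
      case (Suc t)
      then have "length (c (Suc t)) = k" "set (c (Suc t)) \<subseteq> V"
        by (simp_all add: cops_step_def cops_step_subset[of V E k "c t"])
      then show ?case using f by (simp add: c_Suc good_def)
    qed
    have "captured c r"
    proof (rule ccontr)
      assume "\<not> captured c r"
      then have free: "r t \<notin> set (c t)" "r t \<notin> set (c (Suc t))" for t
        by (auto simp: captured_def)
      have step: "P (r (Suc t)) (c (Suc (Suc t))) \<and>
          ((r (Suc t), c (Suc (Suc t))), (r t, c (Suc t))) \<in> W"
        if "P (r t) (c (Suc t))" for t
        using f[of "c (Suc t)" "r t" "r (Suc t)"] valid[of "Suc t"] legal[of t] free[of "Suc t"] that
        by (simp add: c_Suc good_def)
      have "P (r t) (c (Suc t))" for t
      proof (induction t)
        case 0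
        show ?case using f0[OF rV, of 0] free[of 0] by (simp add: c_0 c_1)
      qed (use step in blast)
      with step have "\<forall>t. ((r (Suc t), c (Suc (Suc t))), (r t, c (Suc t))) \<in> W" by blast
      with wf show False
        unfolding wf_iff_no_infinite_down_chain
        by (elim notE, intro exI[of _ "\<lambda>t. (r t, c (Suc t))"])
    qed
    with c0 valid show ?thesis by (simp add: cops_play_iff c_0 flip: c_def)
  qed
  then show ?thesis by (auto simp: cops_win_def)
qed

text \<open>Here \<open>safe r c\<close> is read before the cops move. The given strategy and the
  robber's answers determine each other step by step, which yields a single play that defeats the
  strategy.\<close>

lemma not_cops_winI:
  assumes "V \<noteq> {}"
    and start: "\<And>c. \<lbrakk>length c = k; set c \<subseteq> V\<rbrakk> \<Longrightarrow> \<exists>r\<in>V. safe r c"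
    and flee: "\<And>r c c'. \<lbrakk>safe r c; length c = k; set c \<subseteq> V; cops_step V E k c c'\<rbrakk> \<Longrightarrow>
      \<exists>r'. legal_move V E r r' \<and> safe r' c'"
    and safe: "\<And>r c c'. \<lbrakk>safe r c; length c = k; set c \<subseteq> V; cops_step V E k c c'\<rbrakk> \<Longrightarrow>
      r \<notin> set c \<and> r \<notin> set c'"
  shows "\<not> cops_win V E k"
proof
  assume "cops_win V E k"
  then obtain s where s: "\<And>r. robber_play V E r \<Longrightarrow>
      cops_play V E k (strategy_play s r) \<and> captured (strategy_play s r) r"
    by (auto simp: cops_win_def)
  \<comment> \<open>A strategy is constrained only through plays, so a motionless robber is used to
    see that \<open>s []\<close> is a legal placement.\<close>
  obtain v where "v \<in> V" using \<open>V \<noteq> {}\<close> by blast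
  then have "length (s []) = k" "set (s []) \<subseteq> V"
    using s[of "\<lambda>_. v"]
    by (auto simp: robber_play_def legal_move_def cops_play_def strategy_play_def)
  with start obtain r0 where r0: "r0 \<in> V" "safe r0 (s [])" by blast
  \<comment> \<open>The chosen move is legal even where no safe move exists. Thus the play is legal
    before its safety is known, and the safety proof may use that the cops answer legally.\<close>
  have "\<exists>r'. r \<in> V \<longrightarrow> legal_move V E r r' \<and>
      ((\<exists>r'. legal_move V E r r' \<and> safe r' c) \<longrightarrow> safe r' c)" for r c
    by (metis legal_move_def)
  then obtain f where f: "\<And>r c. r \<in> V \<Longrightarrow> legal_move V E r (f r c) \<and>
      ((\<exists>r'. legal_move V E r r' \<and> safe r' c) \<longrightarrow> safe (f r c) c)"
    by metis
  \<comment> \<open>After the history \<open>h\<close> the robber stands at \<open>last h\<close>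
    and the cops have just moved to \<open>s h\<close>.\<close>
  define next_pos where "next_pos h = (if h = [] then r0 else f (last h) (s h))" for h
  define h where "h = rec_nat [] (\<lambda>_ h. h @ [next_pos h])"
  define r where "r t = next_pos (h t)" for t
  have h_Suc: "h (Suc t) = h t @ [r t]" for t
    by (simp add: h_def r_def)
  have h: "map r [0..<t] = h t" for t
  proof (induction t)
    case 0
    show ?case by (simp add: h_def)
  qed (simp add: h_Suc)
  have r_0: "r 0 = r0"
    using h[of 0] by (simp add: r_def next_pos_def)
  define c where "c = strategy_play s r"
  have r_Suc: "r (Suc t) = f (r t) (c (Suc t))" for t
    using h[of "Suc t"] h_Suc[of t] r_def[of "Suc t"]
    by (simp add: next_pos_def c_def strategy_play_def)
  have rV: "r t \<in> V" for t
    by (induction t) (use r0 f in \<open>auto simp: r_0 r_Suc legal_move_def\<close>)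
  have play: "robber_play V E r"
    using rV f by (simp add: robber_play_def r_Suc)
  have cops: "cops_play V E k c" and captured: "captured c r"
    using s[OF play] by (simp_all add: c_def)
  have step: "cops_step V E k (c t) (c (Suc t))" for t
    using cops by (simp add: cops_play_iff)
  have safe_t: "safe (r t) (c t)" for t
  proof (induction t)
    case 0
    show ?case using r0 by (simp add: r_0 c_def strategy_play_def)
  next
    case (Suc t)
    then show ?case
      using flee[OF Suc cops_playD[OF cops] step] f[OF rV] by (simp add: r_Suc)
  qed
  with safe[OF safe_t cops_playD[OF cops] step] captured show False
    by (auto simp: captured_def)
qed

section \<open>Invariance of the cop number under isomorphism\<close>

lemma cops_win_transfer:
  assumes f: "bij_betw f V V'"
    and E: "\<And>u v. u \<in> V \<Longrightarrow> v \<in> V \<Longrightarrow> E u v \<longleftrightarrow> E' (f u) (f v)"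
    and "cops_win V E k"
  shows "cops_win V' E' k"
proof -
  define g where "g = inv_into V f"
  have g: "g v \<in> V" "f (g v) = v" if "v \<in> V'" for v
    using f that by (auto simp: g_def bij_betw_def inv_into_into f_inv_into_f)
  have f_legal: "legal_move V' E' (f u) (f v)" if "legal_move V E u v" for u v
    using that bij_betwE[OF f] E[of u v] by (auto simp: legal_move_def)
  obtain s where s: "\<And>r. robber_play V E r \<Longrightarrow>
      cops_play V E k (strategy_play s r) \<and> captured (strategy_play s r) r"
    using \<open>cops_win V E k\<close> by (auto simp: cops_win_def)
  \<comment> \<open>The robber is pulled back along \<open>g\<close>, answered in \<open>V\<close>,
    and the answer is pushed forward along \<open>f\<close>.\<close>
  define s' where "s' h = map f (s (map g h))" for h
  have "cops_play V' E' k (strategy_play s' r) \<and> captured (strategy_play s' r) r"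
    if play: "robber_play V' E' r" for r
  proof -
    define c where "c = strategy_play s (g \<circ> r)"
    have rV: "r t \<in> V'" for t
      using play by (auto simp: robber_play_def legal_move_def)
    have "legal_move V E (g u) (g v)" if "legal_move V' E' u v" for u v
      using that g[of u] g[of v] E[of "g u" "g v"] by (auto simp: legal_move_def)
    then have "robber_play V E (g \<circ> r)"
      using play g by (simp add: robber_play_def)
    from s[OF this] have c: "cops_play V E k c" "captured c (g \<circ> r)"
      by (simp_all add: c_def)
    have c': "strategy_play s' r = (\<lambda>t. map f (c t))"
      by (simp add: fun_eq_iff strategy_play_def s'_def c_def)
    have "cops_play V' E' k (\<lambda>t. map f (c t))"
      unfolding cops_play_def
    proof (intro conjI allI impI)
      show "set (map f (c 0)) \<subseteq> V'"
        using cops_playD(2)[OF c(1)] f by (auto simp: bij_betw_def)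
      fix t i assume "i < k"
      with c(1) f_legal show "legal_move V' E' (map f (c t) ! i) (map f (c (Suc t)) ! i)"
        by (simp add: cops_play_def cops_playD[OF c(1)])
    qed (simp_all add: cops_playD[OF c(1)])
    moreover have "captured (\<lambda>t. map f (c t)) r"
    proof -
      have "r t \<in> set (map f xs)" if "(g \<circ> r) t \<in> set xs" for t xs
        using imageI[OF that, of f] g(2)[OF rV] by simp
      with c(2) show ?thesis unfolding captured_def by blast
    qed
    ultimately show ?thesis by (simp add: c')
  qed
  then show ?thesis by (auto simp: cops_win_def)
qed

lemma cop_number_transfer:
  assumes f: "bij_betw f V V'"
    and E: "\<And>u v. u \<in> V \<Longrightarrow> v \<in> V \<Longrightarrow> E u v \<longleftrightarrow> E' (f u) (f v)"
  shows "cop_number V E = cop_number V' E'"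
proof -
  have inv: "bij_betw (inv_into V f) V' V"
    using f by (rule bij_betw_inv_into)
  have E': "E' u v \<longleftrightarrow> E (inv_into V f u) (inv_into V f v)" if "u \<in> V'" "v \<in> V'" for u v
    using that f E[of "inv_into V f u" "inv_into V f v"]
    by (simp add: bij_betw_def inv_into_into f_inv_into_f)
  have "cops_win V E k \<longleftrightarrow> cops_win V' E' k" for k
    using cops_win_transfer[of f V V' E E' k, OF f E]
      cops_win_transfer[of _ V' V E' E k, OF inv E'] by blast
  then show ?thesis by (simp add: cop_number_def)
qed

subsection \<open>Pursuit\<close>

definition cube_adj :: "'a set \<Rightarrow> 'a set \<Rightarrow> bool" where
  "cube_adj A B \<longleftrightarrow> card (sym_diff A B) = 1"

lemma cube_adj_insert: "x \<notin> A \<Longrightarrow> cube_adj A (insert x A)"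
  by (auto simp: cube_adj_def card_1_singleton_iff)

lemma cube_adj_remove: "x \<in> A \<Longrightarrow> cube_adj A (A - {x})"
  by (auto simp: cube_adj_def card_1_singleton_iff)

lemma sym_diff_singletonD: "sym_diff A B = {x} \<Longrightarrow> y \<in> B \<longleftrightarrow> (y \<in> A) \<noteq> (y = x)"
  by (drule eqset_imp_iff[of _ _ y]) auto

lemma cube_adjE:
  assumes "cube_adj A B"
  obtains x where "x \<notin> A" "B = insert x A" | x where "x \<in> A" "B = A - {x}"
proof -
  obtain x where "sym_diff A B = {x}"
    using assms by (auto simp: cube_adj_def card_1_singleton_iff)
  then have B: "y \<in> B \<longleftrightarrow> (y \<in> A) \<noteq> (y = x)" for y
    by (rule sym_diff_singletonD)
  show ?thesis
  proof (cases "x \<in> A")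
    case True
    moreover have "B = A - {x}" by (intro set_eqI) (use B True in auto)
    ultimately show ?thesis by (rule that(2))
  next
    case False
    moreover have "B = insert x A" by (intro set_eqI) (use B False in auto)
    ultimately show ?thesis by (rule that(1))
  qed
qed

text \<open>Intersection with \<open>M\<close> retracts onto the subsets of \<open>M\<close>, so the
  shadow of a cop moves at most one step per turn.\<close>

lemma cube_adj_restrict: "cube_adj A B \<Longrightarrow> A \<inter> M = B \<inter> M \<or> cube_adj (A \<inter> M) (B \<inter> M)"
  by (erule cube_adjE) (auto simp: cube_adj_def card_1_singleton_iff)

text \<open>Hamming distance. In a down-closed family of finite sets it is also the graph distance,
  since it can always be lowered by one (\<open>approach\<close>).\<close>

definition gap :: "'a set \<Rightarrow> 'a set \<Rightarrow> nat" where
  "gap R C = card (sym_diff R C)"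

text \<open>Subgraphs of hypercubes induced by down-sets are known as daisy cubes; \<open>m\<close>
  is the dimension of a largest subcube.\<close>

locale daisy_cube =
  fixes F :: "'a set set" and m :: nat
  assumes finite_member: "A \<in> F \<Longrightarrow> finite A"
    and down_closed: "A \<in> F \<Longrightarrow> B \<subseteq> A \<Longrightarrow> B \<in> F"
    and card_le: "A \<in> F \<Longrightarrow> card A \<le> m"
    and attained: "\<exists>A\<in>F. card A = m"
begin

abbreviation legal :: "'a set \<Rightarrow> 'a set \<Rightarrow> bool" where
  "legal \<equiv> legal_move F cube_adj"

lemma empty_member: "{} \<in> F"
  using attained down_closed by blast

lemma gap_pos: "R \<in> F \<Longrightarrow> C \<in> F \<Longrightarrow> C \<noteq> R \<Longrightarrow> 0 < gap R C"
  using finite_member by (auto simp: gap_def card_gt_0_iff)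

lemma gap_flip:
  assumes "R \<in> F" "R' \<in> F" "C \<in> F" "sym_diff R R' = {i}"
  shows "i \<in> sym_diff R C \<Longrightarrow> Suc (gap R' C) = gap R C"
    and "i \<notin> sym_diff R C \<Longrightarrow> gap R' C = Suc (gap R C)"
proof -
  have fin: "finite (sym_diff R C)" using assms finite_member by blast
  show "Suc (gap R' C) = gap R C" if "i \<in> sym_diff R C"
  proof -
    have "sym_diff R' C = sym_diff R C - {i}"
      by (intro set_eqI) (use that sym_diff_singletonD[OF assms(4)] in auto)
    then show ?thesis unfolding gap_def using card_Suc_Diff1[OF fin that] by simp
  qed
  show "gap R' C = Suc (gap R C)" if "i \<notin> sym_diff R C"
  proof -
    have "sym_diff R' C = insert i (sym_diff R C)"
      by (intro set_eqI) (use that sym_diff_singletonD[OF assms(4)] in auto)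
    then show ?thesis unfolding gap_def using card_insert_disjoint[OF fin that] by simp
  qed
qed

lemma gap_commute: "gap R C = gap C R"
  by (simp add: gap_def Un_commute)

text \<open>Deleting a surplus element never leaves \<open>F\<close>. An element is added only when
  \<open>C \<subseteq> R\<close>, and the result then still lies inside \<open>R\<close>.\<close>

lemma approach:
  assumes "R \<in> F" "C \<in> F" "C \<noteq> R"
  shows "\<exists>C'. legal C C' \<and> Suc (gap R C') = gap R C"
proof -
  obtain C' x where C': "C' \<in> F" "cube_adj C C'" "sym_diff C C' = {x}" "x \<in> sym_diff C R"
  proof (cases "C \<subseteq> R")
    case True
    with assms obtain x where x: "x \<in> R" "x \<notin> C" by blast
    have "insert x C \<in> F" using True x assms down_closed[of R] by blast
    then show ?thesis using x by (intro that[of "insert x C" x]) (auto intro: cube_adj_insert)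
  next
    case False
    then obtain x where x: "x \<in> C" "x \<notin> R" by blast
    have "C - {x} \<in> F" using assms down_closed[of C] by blast
    then show ?thesis using x by (intro that[of "C - {x}" x]) (auto intro: cube_adj_remove)
  qed
  have "Suc (gap C' R) = gap C R"
    by (rule gap_flip[of C C' R x]) (use assms C' in auto)
  with C' assms show ?thesis by (auto simp: legal_move_def gap_commute)
qed

text \<open>The robber's flip and the cop's approach each change the gap by one, so the parity is
  restored. The net change is 0, or -2 if the flip was towards the cop.\<close>

lemma follow:
  assumes "R \<in> F" "R' \<in> F" "C \<in> F" "sym_diff R R' = {i}"
  shows "\<exists>C'. legal C C' \<and> (C' = R' \<or>
    gap R' C' \<le> gap R C \<and> (odd (gap R' C') \<longleftrightarrow> odd (gap R C)) \<and>
    (i \<in> sym_diff R C \<longrightarrow> gap R' C' < gap R C))"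
proof (cases "C = R'")
  case True
  with assms show ?thesis by (intro exI[of _ C]) (simp add: legal_move_def)
next
  case False
  have flip: "i \<in> sym_diff R C \<longrightarrow> Suc (gap R' C) = gap R C"
    "i \<notin> sym_diff R C \<longrightarrow> gap R' C = Suc (gap R C)"
    using gap_flip[OF assms] by blast+
  obtain C' where C': "legal C C'" "Suc (gap R' C') = gap R' C"
    using approach[of R' C] False assms by blast
  show ?thesis
  proof (intro exI[of _ C'] conjI disjI2)
    show "gap R' C' \<le> gap R C"
      using flip C'(2) by (cases "i \<in> sym_diff R C") linarith+
    have "gap R C = gap R' C' \<or> gap R C = Suc (Suc (gap R' C'))"
      using flip C'(2) by (cases "i \<in> sym_diff R C") linarith+
    then show "odd (gap R' C') \<longleftrightarrow> odd (gap R C)" by auto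
    show "i \<in> sym_diff R C \<longrightarrow> gap R' C' < gap R C"
      using flip C'(2) by linarith
  qed (fact C')
qed

lemma legal_insert: "C \<in> F \<Longrightarrow> insert x C \<in> F \<Longrightarrow> legal C (insert x C)"
  by (cases "x \<in> C") (auto simp: legal_move_def insert_absorb intro: cube_adj_insert)

lemma legal_remove: "C \<in> F \<Longrightarrow> legal C (C - {x})"
  using down_closed[of C "C - {x}"]
  by (cases "x \<in> C") (auto simp: legal_move_def intro: cube_adj_remove)

section \<open>The invariant and the measure of the pursuit\<close>

definition pursuit :: "nat \<Rightarrow> 'a set \<Rightarrow> 'a set list \<Rightarrow> bool" where
  "pursuit k R cs \<longleftrightarrow> R \<in> F \<and> length cs = k \<and> (\<forall>j<k. cs ! j \<in> F \<and> cs ! j \<noteq> R) \<and>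
     (\<forall>i<k. \<forall>j<k. odd (gap R (cs ! i)) \<longrightarrow> odd (gap R (cs ! j)) \<longrightarrow> i = j)"

text \<open>The components are compared lexicographically. The third one needs truncated subtraction:
  the union has at most \<open>m\<close> elements only once all cops are inside \<open>R\<close>.\<close>

definition descent :: "nat \<Rightarrow> (('a set \<times> 'a set list) \<times> ('a set \<times> 'a set list)) set" where
  "descent k = measures
     [\<lambda>(R, cs). \<Sum>j<k. gap R (cs ! j),
      \<lambda>(R, cs). \<Sum>j<k. card (cs ! j - R),
      \<lambda>(R, cs). m - card (\<Union>j<k. sym_diff R (cs ! j)),
      \<lambda>(R, cs). card R]"

lemma pursuit_step:
  assumes "pursuit k R cs" "R' \<in> F" "length cs' = k"
    and "\<And>j. j < k \<Longrightarrow> legal (cs ! j) (cs' ! j)"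
    and "\<And>j. j < k \<Longrightarrow> cs' ! j \<noteq> R'"
    and "\<And>j. j < k \<Longrightarrow> odd (gap R' (cs' ! j)) \<longleftrightarrow> odd (gap R (cs ! j))"
  shows "cops_step F cube_adj k cs cs'" "pursuit k R' cs'"
  using assms by (auto simp: cops_step_def pursuit_def legal_move_def)

lemma gap_self [simp]: "gap R R = 0"
  by (simp add: gap_def)

lemma gap_pos_neq: "0 < gap R C \<Longrightarrow> C \<noteq> R"
  by auto

lemma pursuit_gap_pos: "pursuit k R cs \<Longrightarrow> j < k \<Longrightarrow> 0 < gap R (cs ! j)"
  by (auto simp: pursuit_def gap_pos)

text \<open>A positive even gap is at least 2 and the only possible odd gap at least 1, so the sum
  is at least \<open>2 * k - 1\<close>.\<close>

lemma pursuit_sum_gap: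
  assumes "pursuit k R cs" "m < 2 * k"
  shows "m \<le> (\<Sum>j<k. gap R (cs ! j))"
proof -
  define g where "g j = gap R (cs ! j)" for j
  have pos: "0 < g j" if "j < k" for j
    using pursuit_gap_pos[OF assms(1) that] by (simp add: g_def)
  have odd: "i = j" if "odd (g i)" "odd (g j)" "i < k" "j < k" for i j
    using assms(1) that by (auto simp: pursuit_def g_def)
  have even: "2 \<le> g j" if "even (g j)" "j < k" for j
    using that pos[of j] by (auto elim!: evenE)
  have "2 * k \<le> Suc (\<Sum>j<k. g j)"
  proof (cases "\<exists>j<k. odd (g j)")
    case True
    then obtain j where j: "j < k" "odd (g j)" by blast
    have "(\<Sum>i\<in>{..<k} - {j}. 2) \<le> (\<Sum>i\<in>{..<k} - {j}. g i)"
      using odd even j by (intro sum_mono) auto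
    moreover have "(\<Sum>i<k. g i) = g j + (\<Sum>i\<in>{..<k} - {j}. g i)"
      using j by (simp add: sum.remove)
    ultimately show ?thesis using pos[OF j(1)] j(1) by simp
  next
    case False
    then have "(\<Sum>i<k. 2) \<le> (\<Sum>i<k. g i)"
      using even by (intro sum_mono) auto
    then show ?thesis by simp
  qed
  with assms(2) show ?thesis by (simp add: g_def)
qed

section \<open>The cops' replies to each kind of robber move\<close>

lemma reply_stay:
  assumes P: "pursuit k R cs" and "0 < k"
  shows "\<exists>cs'. cops_step F cube_adj k cs cs' \<and>
    (R \<in> set cs' \<or> pursuit k R cs' \<and> ((R, cs'), (R, cs)) \<in> descent k)"
proof -
  have cs: "R \<in> F" "length cs = k" "\<And>j. j < k \<Longrightarrow> cs ! j \<in> F" "\<And>j. j < k \<Longrightarrow> cs ! j \<noteq> R"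
    and odd: "\<And>i j. \<lbrakk>i < k; j < k; odd (gap R (cs ! i)); odd (gap R (cs ! j))\<rbrakk> \<Longrightarrow> i = j"
    using P by (auto simp: pursuit_def)
  \<comment> \<open>Cop \<open>l\<close> is the odd one if there is one, and arbitrary otherwise.
    All other gaps are even, so moving \<open>l\<close> alone leaves at most one odd gap and lowers
    the sum.\<close>
  obtain l where l: "l < k" "\<And>j. j < k \<Longrightarrow> odd (gap R (cs ! j)) \<Longrightarrow> j = l"
    using odd \<open>0 < k\<close> by metis
  obtain C where C: "legal (cs ! l) C" "Suc (gap R C) = gap R (cs ! l)"
    using approach[of R "cs ! l"] cs l by blast
  define cs' where "cs' = cs[l := C]"
  have nth: "cs' ! j = (if j = l then C else cs ! j)" if "j < k" for j
    using that cs by (simp add: cs'_def nth_list_update)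
  have "length cs' = k" by (simp add: cs'_def cs)
  then have "cops_step F cube_adj k cs cs'"
    using C(1) cs by (simp add: cops_step_def nth legal_move_def)
  moreover have "pursuit k R cs'" if "C \<noteq> R"
    using C l cs that \<open>length cs' = k\<close> by (auto simp: pursuit_def nth legal_move_def)
  moreover have "R \<in> set cs'" if "C = R"
    using that cs l by (simp add: cs'_def set_update_memI)
  moreover have "(\<Sum>j<k. gap R (cs' ! j)) < (\<Sum>j<k. gap R (cs ! j))"
    using C l(1) by (intro sum_strict_mono_ex1) (auto simp: nth)
  ultimately show ?thesis by (auto simp: descent_def)
qed

text \<open>Every cop follows. Unless a capture occurs, no gap grows, and that of cop
  \<open>l\<close>, whom the robber approached, shrinks; so the gap sum falls.\<close>

lemma reply_towards:
  assumes P: "pursuit k R cs" and R': "R' \<in> F" "sym_diff R R' = {i}"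
    and l: "l < k" "i \<in> sym_diff R (cs ! l)"
  shows "\<exists>cs'. cops_step F cube_adj k cs cs' \<and>
    (R' \<in> set cs' \<or> pursuit k R' cs' \<and> ((R', cs'), (R, cs)) \<in> descent k)"
proof -
  have "R \<in> F" "\<forall>j<k. cs ! j \<in> F"
    using P by (auto simp: pursuit_def)
  then have "\<forall>j<k. \<exists>C'. legal (cs ! j) C' \<and> (C' = R' \<or>
    gap R' C' \<le> gap R (cs ! j) \<and> (odd (gap R' C') \<longleftrightarrow> odd (gap R (cs ! j))) \<and>
    (i \<in> sym_diff R (cs ! j) \<longrightarrow> gap R' C' < gap R (cs ! j)))"
    using follow R' by blast
  then obtain cs' where cs': "length cs' = k" "\<And>j. j < k \<Longrightarrow> legal (cs ! j) (cs' ! j)"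
    "\<And>j. j < k \<Longrightarrow> cs' ! j = R' \<or> gap R' (cs' ! j) \<le> gap R (cs ! j) \<and>
      (odd (gap R' (cs' ! j)) \<longleftrightarrow> odd (gap R (cs ! j))) \<and>
      (i \<in> sym_diff R (cs ! j) \<longrightarrow> gap R' (cs' ! j) < gap R (cs ! j))"
    unfolding Skolem_list_nth by blast
  show ?thesis
  proof (cases "R' \<in> set cs'")
    case True
    with cs' show ?thesis by (auto simp: cops_step_def)
  next
    case False
    then have ne: "cs' ! j \<noteq> R'" if "j < k" for j
      using that cs'(1) nth_mem by blast
    have "(\<Sum>j<k. gap R' (cs' ! j)) < (\<Sum>j<k. gap R (cs ! j))"
      using cs'(3) ne l by (intro sum_strict_mono_ex1) blast+
    with pursuit_step[OF P R'(1) cs'(1)] cs' ne show ?thesis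
      by (auto simp: descent_def)
  qed
qed

text \<open>When every cop deletes \<open>i\<close> too, all sets \<open>sym_diff R (cs ! j)\<close>
  and \<open>cs ! j - R\<close> are preserved, and of the components of \<open>descent\<close> only
  \<open>card R\<close> changes.\<close>

lemma reply_remove:
  assumes P: "pursuit k R cs" and i: "i \<in> R" "\<And>j. j < k \<Longrightarrow> i \<in> cs ! j"
  shows "\<exists>cs'. cops_step F cube_adj k cs cs' \<and>
    pursuit k (R - {i}) cs' \<and> ((R - {i}, cs'), (R, cs)) \<in> descent k"
proof -
  have cs: "R \<in> F" "length cs = k" "\<And>j. j < k \<Longrightarrow> cs ! j \<in> F"
    using P by (auto simp: pursuit_def)
  define cs' where "cs' = map (\<lambda>C. C - {i}) cs"
  have nth: "cs' ! j = cs ! j - {i}" if "j < k" for j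
    using that cs by (simp add: cs'_def)
  have D: "sym_diff (R - {i}) (cs' ! j) = sym_diff R (cs ! j)"
    and N: "cs' ! j - (R - {i}) = cs ! j - R" if "j < k" for j
    using i that by (auto simp: nth)
  have gap: "gap (R - {i}) (cs' ! j) = gap R (cs ! j)" if "j < k" for j
    using D[OF that] by (simp add: gap_def)
  have "cs' ! j \<noteq> R - {i}" if "j < k" for j
    by (rule gap_pos_neq) (simp add: gap[OF that] pursuit_gap_pos[OF P that])
  moreover have "card (R - {i}) < card R"
    using card_Diff1_less[OF finite_member[OF cs(1)] i(1)] .
  ultimately show ?thesis
    using pursuit_step[OF P, of "R - {i}" cs'] cs D N gap down_closed[of R "R - {i}"]
    by (intro exI[of _ cs']) (auto simp: descent_def cs'_def legal_remove)
qed

text \<open>Cops inside \<open>R\<close> copy the insertion. The others delete an element outside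
  \<open>R\<close>, which offsets the growth of their gap and lowers the second component of
  \<open>descent\<close>.\<close>

lemma reply_insert_above:
  assumes P: "pursuit k R cs" and R': "insert i R \<in> F" "i \<notin> R"
    and i: "\<And>j. j < k \<Longrightarrow> i \<notin> cs ! j" and l: "l < k" "\<not> cs ! l \<subseteq> R"
  shows "\<exists>cs'. cops_step F cube_adj k cs cs' \<and>
    pursuit k (insert i R) cs' \<and> ((insert i R, cs'), (R, cs)) \<in> descent k"
proof -
  have cs: "R \<in> F" "length cs = k" "\<And>j. j < k \<Longrightarrow> cs ! j \<in> F"
    using P by (auto simp: pursuit_def)
  have "\<exists>C'. legal C C' \<and> gap (insert i R) C' = gap R C \<and>
      card (C' - insert i R) \<le> card (C - R) \<and>
      (\<not> C \<subseteq> R \<longrightarrow> card (C' - insert i R) < card (C - R))" if C: "C \<in> F" "i \<notin> C" for C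
  proof (cases "C \<subseteq> R")
    case True
    then have "sym_diff (insert i R) (insert i C) = sym_diff R C"
      and "insert i C - insert i R = {}"
      using R' C by auto
    moreover have "insert i C \<in> F" using True R' down_closed[of "insert i R"] by blast
    ultimately show ?thesis using C True
      by (intro exI[of _ "insert i C"]) (simp add: legal_insert gap_def)
  next
    case False
    then obtain x where x: "x \<in> C" "x \<notin> R" by blast
    have C': "C - {x} \<in> F" using C down_closed by blast
    have "gap (insert i R) C = Suc (gap R C)"
      by (rule gap_flip(2)) (use R' C cs in auto)
    moreover have "Suc (gap (C - {x}) (insert i R)) = gap C (insert i R)"
      by (rule gap_flip(1)[of _ _ _ x]) (use R' C C' x in auto)
    moreover have "card (C - {x} - insert i R) < card (C - R)"
      using C x finite_member by (intro psubset_card_mono) auto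
    ultimately show ?thesis using C
      by (intro exI[of _ "C - {x}"]) (simp add: legal_remove gap_commute)
  qed
  then have "\<forall>j<k. \<exists>C'. legal (cs ! j) C' \<and> gap (insert i R) C' = gap R (cs ! j) \<and>
      card (C' - insert i R) \<le> card (cs ! j - R) \<and>
      (\<not> cs ! j \<subseteq> R \<longrightarrow> card (C' - insert i R) < card (cs ! j - R))"
    using cs i by blast
  then obtain cs' where cs': "length cs' = k" "\<And>j. j < k \<Longrightarrow> legal (cs ! j) (cs' ! j)"
    "\<And>j. j < k \<Longrightarrow> gap (insert i R) (cs' ! j) = gap R (cs ! j)"
    "\<And>j. j < k \<Longrightarrow> card (cs' ! j - insert i R) \<le> card (cs ! j - R)"
    "\<And>j. j < k \<Longrightarrow> \<not> cs ! j \<subseteq> R \<Longrightarrow> card (cs' ! j - insert i R) < card (cs ! j - R)"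
    unfolding Skolem_list_nth by blast
  have "cs' ! j \<noteq> insert i R" if "j < k" for j
    by (rule gap_pos_neq) (simp add: cs'(3)[OF that] pursuit_gap_pos[OF P that])
  moreover have "(\<Sum>j<k. card (cs' ! j - insert i R)) < (\<Sum>j<k. card (cs ! j - R))"
    using cs'(4,5) l by (intro sum_strict_mono_ex1) blast+
  ultimately show ?thesis
    using pursuit_step[OF P R'(1) cs'(1)] cs'
    by (intro exI[of _ cs']) (auto simp: descent_def)
qed

text \<open>Two cops \<open>p\<close> and \<open>q\<close> miss a common element \<open>a\<close> of
  \<open>R\<close>. Cop \<open>p\<close> adds \<open>a\<close> while the others copy the robber: in
  the difference of \<open>p\<close>, \<open>i\<close> replaces \<open>a\<close>, and
  \<open>q\<close> keeps \<open>a\<close> in the union, which therefore grows by \<open>i\<close>.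
  All gaps are unchanged.\<close>

lemma reply_insert_below:
  assumes P: "pursuit k R cs" and k: "m < 2 * k" and R': "insert i R \<in> F" "i \<notin> R"
    and below: "\<And>j. j < k \<Longrightarrow> cs ! j \<subseteq> R"
  shows "\<exists>cs'. cops_step F cube_adj k cs cs' \<and>
    pursuit k (insert i R) cs' \<and> ((insert i R, cs'), (R, cs)) \<in> descent k"
proof -
  have cs: "R \<in> F" "length cs = k" "\<And>j. j < k \<Longrightarrow> cs ! j \<in> F"
    using P by (auto simp: pursuit_def)
  have fin: "finite R" using cs finite_member by blast
  \<comment> \<open>The strict bound serves twice: it rules out disjoint differences, and it makes
    the truncated subtraction in \<open>descent\<close> decrease strictly.\<close>
  have card_R: "card R < m" using card_le[OF R'(1)] R'(2) fin by simp
  define D where "D j = sym_diff R (cs ! j)" for j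
  have D: "D j \<subseteq> R" if "j < k" for j
    using below[OF that] by (auto simp: D_def)
  have "\<not> disjoint_family_on D {..<k}"
  proof
    assume "disjoint_family_on D {..<k}"
    then have "card (\<Union>j<k. D j) = (\<Sum>j<k. gap R (cs ! j))"
      using D fin by (subst card_UN_disjoint') (auto simp: gap_def D_def intro: finite_subset)
    moreover have "card (\<Union>j<k. D j) \<le> card R"
      using D fin by (intro card_mono) auto
    ultimately show False
      using pursuit_sum_gap[OF P k] card_R by linarith
  qed
  then obtain p q a where pq: "p < k" "q < k" "p \<noteq> q" and a: "a \<in> D p" "a \<in> D q"
    by (auto simp: disjoint_family_on_def)
  have a': "a \<in> R" "a \<notin> cs ! p" using a(1) D[OF pq(1)] by (auto simp: D_def)
  define cs' where "cs' = (map (insert i) cs)[p := insert a (cs ! p)]"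
  have nth: "cs' ! j = (if j = p then insert a (cs ! p) else insert i (cs ! j))" if "j < k" for j
    using that cs by (simp add: cs'_def nth_list_update)
  have len: "length cs' = k" by (simp add: cs'_def cs)
  have sub: "cs' ! j \<subseteq> insert i R" if "j < k" for j
    using that below pq(1) a' by (auto simp: nth)
  have legal: "legal (cs ! j) (cs' ! j)" if "j < k" for j
    using sub[OF that] down_closed[OF R'(1)] that cs by (auto simp: nth intro!: legal_insert)
  have D': "sym_diff (insert i R) (cs' ! j) = (if j = p then insert i (D j - {a}) else D j)"
    if "j < k" for j
    using that R' below[OF that] a' by (auto simp: nth D_def)
  have "card (insert i (D p - {a})) = card (D p)"
    using R'(2) D[OF pq(1)] finite_subset[OF D[OF pq(1)] fin] card_Suc_Diff1[OF _ a(1)]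
    by (subst card_insert_disjoint) auto
  then have gap: "gap (insert i R) (cs' ! j) = gap R (cs ! j)" if "j < k" for j
    using D'[OF that] by (auto simp: gap_def D_def)
  have ne: "cs' ! j \<noteq> insert i R" if "j < k" for j
    by (rule gap_pos_neq) (simp add: gap[OF that] pursuit_gap_pos[OF P that])
  have "(\<Union>j<k. sym_diff (insert i R) (cs' ! j)) = insert i (\<Union>j<k. D j)"
    using pq a D' by (auto split: if_splits)
  moreover have "card (insert i (\<Union>j<k. D j)) = Suc (card (\<Union>j<k. D j))"
    using D R'(2) finite_subset[OF _ fin] by (subst card_insert_disjoint) blast+
  moreover have "card (\<Union>j<k. D j) \<le> card R"
    using D fin by (intro card_mono) auto
  ultimately have "m - card (\<Union>j<k. sym_diff (insert i R) (cs' ! j)) < m - card (\<Union>j<k. D j)"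
    using card_R by simp
  moreover have "(\<Sum>j<k. card (cs' ! j - insert i R)) = (\<Sum>j<k. card (cs ! j - R))"
    using sub below by (intro sum.cong) (auto simp: Diff_eq_empty_iff[THEN iffD2])
  ultimately show ?thesis
    using pursuit_step[OF P R'(1) len legal ne] gap
    by (intro exI[of _ cs']) (auto simp: descent_def D_def)
qed

text \<open>If the flipped element lies in some cop's difference, the robber has approached that
  cop. Otherwise every cop agrees with him on that element, as the replies to other insertions and
  removals require.\<close>

lemma reply:
  assumes P: "pursuit k R cs" and k: "m < 2 * k" and R': "legal R R'"
  shows "\<exists>cs'. cops_step F cube_adj k cs cs' \<and>
    (R' \<in> set cs' \<or> pursuit k R' cs' \<and> ((R', cs'), (R, cs)) \<in> descent k)"
proof -
  consider "R' = R" | i where "i \<notin> R" "R' = insert i R" | i where "i \<in> R" "R' = R - {i}"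
    using R' by (auto simp: legal_move_def elim: cube_adjE)
  then show ?thesis
  proof cases
    case 1
    with reply_stay[OF P] k show ?thesis by auto
  next
    case (2 i)
    have "R' \<in> F" using R' by (simp add: legal_move_def)
    have i: "sym_diff R R' = {i}" using 2 by auto
    show ?thesis
    proof (cases "\<exists>j<k. i \<in> sym_diff R (cs ! j)")
      case True
      with reply_towards[OF P \<open>R' \<in> F\<close> i] show ?thesis by blast
    next
      case False
      with 2 have "i \<notin> cs ! j" if "j < k" for j using that by blast
      with reply_insert_above[OF P] reply_insert_below[OF P k] 2 \<open>R' \<in> F\<close>
      show ?thesis by metis
    qed
  next
    case (3 i)
    have "R' \<in> F" using R' by (simp add: legal_move_def)
    have i: "sym_diff R R' = {i}" using 3 by auto
    show ?thesis
    proof (cases "\<exists>j<k. i \<in> sym_diff R (cs ! j)")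
      case True
      with reply_towards[OF P \<open>R' \<in> F\<close> i] show ?thesis by blast
    next
      case False
      with 3 reply_remove[OF P, of i] show ?thesis by blast
    qed
  qed
qed

lemma cops_win_upper:
  assumes "m < 2 * k"
  shows "cops_win F cube_adj k"
proof (rule cops_winI)
  show "length (replicate k ({} :: 'a set)) = k" by simp
  show "set (replicate k {}) \<subseteq> F" using empty_member by auto
  show "wf (descent k)" by (simp add: descent_def)
  fix R assume R: "R \<in> F"
  show "\<exists>cs. cops_step F cube_adj k (replicate k {}) cs \<and>
    (R \<in> set (replicate k {}) \<or> R \<in> set cs \<or> pursuit k R cs)"
  proof -
    \<comment> \<open>All cops start at the empty set and move together; one step of approach
      repairs an odd parity, so all gaps become even at once.\<close>
    obtain C where C: "legal {} C" "R = {} \<or> even (gap R C)"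
    proof (cases "R = {} \<or> even (gap R {})")
      case True
      with that[of "{}"] empty_member show ?thesis by (auto simp: legal_move_def)
    next
      case False
      then obtain C where "legal {} C" "Suc (gap R C) = gap R {}"
        using approach[OF R empty_member] by auto
      with False show ?thesis by (metis even_Suc that)
    qed
    have "R \<in> set (replicate k {}) \<or> R \<in> set (replicate k C) \<or> pursuit k R (replicate k C)"
      using C R assms by (auto simp: pursuit_def legal_move_def)
    moreover have "cops_step F cube_adj k (replicate k {}) (replicate k C)"
      using C by (simp add: cops_step_def)
    ultimately show ?thesis by blast
  qed
qed (use reply assms in blast)

end

subsection \<open>Evasion\<close>

lemma cube_adj_commute: "cube_adj A B \<longleftrightarrow> cube_adj B A"
  by (simp add: cube_adj_def Un_commute)

lemma cube_adjD: "cube_adj A B \<Longrightarrow> \<exists>x. \<forall>y. y \<in> B \<longleftrightarrow> (y \<in> A) \<noteq> (y = x)"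
  by (erule cube_adjE) auto

text \<open>If \<open>A\<close> and \<open>T\<close> differ in one element, only these two sets
  qualify. If they differ in \<open>d\<close> and \<open>e\<close>, then \<open>B\<close> has to
  flip one of these two to come within one step of \<open>T\<close>.\<close>

lemma dominated_neighbours:
  assumes "A \<noteq> T"
  obtains P Q where "{B. (B = A \<or> cube_adj A B) \<and> (B = T \<or> cube_adj B T)} \<subseteq> {P, Q}"
proof -
  obtain d where d: "(d \<in> A) \<noteq> (d \<in> T)" using assms by blast
  have reach: "(\<exists>z. \<forall>y. y \<in> T \<longleftrightarrow> (y \<in> B) \<noteq> (y = z)) \<or> (\<forall>y. y \<in> T \<longleftrightarrow> y \<in> B)"
    if "B = T \<or> cube_adj B T" for B
    using that cube_adjD by blast
  show ?thesis
  proof (cases "\<exists>e. e \<noteq> d \<and> (e \<in> A) \<noteq> (e \<in> T)")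
    case False
    have "B = A \<or> B = sym_diff A {d}" if "B = A \<or> cube_adj A B" "B = T \<or> cube_adj B T" for B
    proof (cases "B = A")
      case False
      with that obtain x where x: "\<And>y. y \<in> B \<longleftrightarrow> (y \<in> A) \<noteq> (y = x)"
        using cube_adjD by blast
      have "x = d"
        using reach[OF that(2)] x \<open>\<not> (\<exists>e. e \<noteq> d \<and> (e \<in> A) \<noteq> (e \<in> T))\<close> d by metis
      then show ?thesis using x by blast
    qed simp
    with that[of A "sym_diff A {d}"] show ?thesis by blast
  next
    case True
    then obtain e where e: "e \<noteq> d" "(e \<in> A) \<noteq> (e \<in> T)" by blast
    have "B = sym_diff A {d} \<or> B = sym_diff A {e}"
      if "B = A \<or> cube_adj A B" "B = T \<or> cube_adj B T" for B
    proof -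
      have "B \<noteq> A" using reach[OF that(2)] d e by metis
      with that obtain x where x: "\<And>y. y \<in> B \<longleftrightarrow> (y \<in> A) \<noteq> (y = x)"
        using cube_adjD by blast
      have "x = d \<or> x = e"
        using reach[OF that(2)] x d e by metis
      then show ?thesis using x by blast
    qed
    with that[of "sym_diff A {d}" "sym_diff A {e}"] show ?thesis by blast
  qed
qed

text \<open>Staying or flipping one element of \<open>M\<close> gives \<open>card M + 1\<close>
  options, and each member of \<open>Ts\<close> rules out at most two of them.\<close>

lemma escape:
  assumes "finite M" "A \<subseteq> M" "A \<notin> set Ts" "2 * length Ts \<le> card M"
  obtains B where "B \<subseteq> M" "B = A \<or> cube_adj A B"
    "\<And>T. T \<in> set Ts \<Longrightarrow> B \<noteq> T \<and> \<not> cube_adj B T"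
proof -
  define opts where "opts = insert A ((\<lambda>x. sym_diff A {x}) ` M)"
  define dominated where
    "dominated T = {B. (B = A \<or> cube_adj A B) \<and> (B = T \<or> cube_adj B T)}" for T
  have opts: "B \<subseteq> M" "B = A \<or> cube_adj A B" if "B \<in> opts" for B
    using that assms(2) by (auto simp: opts_def cube_adj_def card_1_singleton_iff)
  have "inj_on (\<lambda>x. sym_diff A {x}) M" by (intro inj_onI) blast
  moreover have "A \<notin> (\<lambda>x. sym_diff A {x}) ` M" by blast
  ultimately have card_opts: "card opts = Suc (card M)"
    using assms(1) by (simp add: opts_def card_image)
  have dom: "finite (dominated T) \<and> card (dominated T) \<le> 2" if T: "T \<in> set Ts" for T
  proof -
    have "A \<noteq> T" using T assms(3) by blast
    then obtain P Q where "dominated T \<subseteq> {P, Q}"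
      unfolding dominated_def by (rule dominated_neighbours)
    then show ?thesis
      using card_mono[of "{P, Q}" "dominated T"] card_insert_le_m1[of 2 "{Q}" P]
      by (auto intro: finite_subset)
  qed
  have "card (\<Union>T\<in>set Ts. dominated T) \<le> (\<Sum>T\<in>set Ts. card (dominated T))"
    by (rule card_UN_le) simp
  also have "\<dots> \<le> (\<Sum>T\<in>set Ts. 2)"
    using dom by (intro sum_mono) blast
  also have "\<dots> \<le> 2 * length Ts" by (simp add: card_length)
  finally have "card (\<Union>T\<in>set Ts. dominated T) < card opts"
    using assms(4) card_opts by simp
  then have "\<not> opts \<subseteq> (\<Union>T\<in>set Ts. dominated T)"
    using dom card_mono[of "\<Union>T\<in>set Ts. dominated T" opts] by fastforce
  then obtain B where "B \<in> opts" "B \<notin> (\<Union>T\<in>set Ts. dominated T)" by blast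
  with opts[of B] that[of B] show ?thesis by (auto simp: dominated_def)
qed

context daisy_cube
begin

lemma not_cops_win_lower:
  assumes k: "2 * k \<le> m"
  shows "\<not> cops_win F cube_adj k"
proof -
  obtain M where M: "M \<in> F" "card M = m" using attained by blast
  have fin: "finite M" using M finite_member by blast
  have sub: "A \<in> F" if "A \<subseteq> M" for A using that M down_closed by blast
  \<comment> \<open>A robber inside \<open>M\<close> is his own shadow, so a cop who catches him has
    shadow \<open>A\<close>. Safety keeps all shadows at distance at least two, out of reach of one
    cop move.\<close>
  define safe where
    "safe A cs \<longleftrightarrow> A \<subseteq> M \<and> (\<forall>C\<in>set cs. A \<noteq> C \<inter> M \<and> \<not> cube_adj A (C \<inter> M))" for A cs
  have flee: "\<exists>B. legal A B \<and> safe B cs"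
    if A: "A \<subseteq> M" "\<And>C. C \<in> set cs \<Longrightarrow> A \<noteq> C \<inter> M" and len: "length cs = k" for A cs
  proof -
    have "A \<notin> set (map (\<lambda>C. C \<inter> M) cs)" using A(2) by auto
    moreover have "2 * length (map (\<lambda>C. C \<inter> M) cs) \<le> card M" using k len M by simp
    ultimately obtain B where "B \<subseteq> M" "B = A \<or> cube_adj A B"
      "\<And>T. T \<in> set (map (\<lambda>C. C \<inter> M) cs) \<Longrightarrow> B \<noteq> T \<and> \<not> cube_adj B T"
      using escape[OF fin A(1)] by blast
    then show ?thesis using A sub by (intro exI[of _ B]) (auto simp: legal_move_def safe_def)
  qed
  have unreached: "A \<noteq> C \<inter> M \<and> A \<noteq> C' \<inter> M"
    if "safe A cs" "length cs = k" "cops_step F cube_adj k cs cs'" "i < k" "C = cs ! i" "C' = cs' ! i"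
    for A cs cs' C C' i
  proof -
    have "C' = C \<or> cube_adj C C'" "C \<in> set cs"
      using that by (auto simp: cops_step_def legal_move_def)
    moreover have "A \<noteq> C \<inter> M" "\<not> cube_adj A (C \<inter> M)"
      using that(1) \<open>C \<in> set cs\<close> by (auto simp: safe_def)
    ultimately show ?thesis
      using cube_adj_restrict[of C C' M] cube_adj_commute[of A] by auto
  qed
  show ?thesis
  proof (rule not_cops_winI[where safe = safe])
    show "F \<noteq> {}" using M by blast
  next
    fix cs :: "'a set list" assume len: "length cs = k"
    \<comment> \<open>As \<open>k \<le> m < 2 ^ m\<close>, some \<open>A \<subseteq> M\<close> is no
      cop's shadow. It may be adjacent to one; a fictitious move by \<open>flee\<close> leads from
      there to a safe start.\<close>
    have "card (set (map (\<lambda>C. C \<inter> M) cs)) \<le> k"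
      using card_length[of "map (\<lambda>C. C \<inter> M) cs"] len by simp
    also have "k \<le> m" using k by simp
    also have "m < card (Pow M)" using M fin by (simp add: card_Pow less_exp)
    finally have "\<not> Pow M \<subseteq> set (map (\<lambda>C. C \<inter> M) cs)"
      using card_mono[of "set (map (\<lambda>C. C \<inter> M) cs)" "Pow M"] by auto
    then obtain A where "A \<subseteq> M" "\<And>C. C \<in> set cs \<Longrightarrow> A \<noteq> C \<inter> M" by auto
    from flee[OF this len] show "\<exists>A\<in>F. safe A cs" by (auto simp: legal_move_def)
  next
    fix A cs cs' assume A: "safe A cs" "length cs = k" "cops_step F cube_adj k cs cs'"
    then have len: "length cs' = k" by (simp add: cops_step_def)
    then have "A \<noteq> C \<inter> M" if "C \<in> set cs'" for C
      using that unreached[OF A] by (auto simp: in_set_conv_nth)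
    with flee len A(1) show "\<exists>B. legal A B \<and> safe B cs'" by (simp add: safe_def)
  next
    fix A cs cs' assume A: "safe A cs" "length cs = k" "cops_step F cube_adj k cs cs'"
    have "A \<inter> M = A" using A(1) by (auto simp: safe_def)
    moreover have "length cs' = k" using A by (simp add: cops_step_def)
    ultimately show "A \<notin> set cs \<and> A \<notin> set cs'"
      using unreached[OF A] A(2) by (metis in_set_conv_nth)
  qed
qed

theorem cop_number_daisy_cube: "cop_number F cube_adj = m div 2 + 1"
  unfolding cop_number_def
proof (rule Least_equality)
  show "cops_win F cube_adj (m div 2 + 1)" by (rule cops_win_upper) simp
next
  fix k assume "cops_win F cube_adj k"
  then have "\<not> 2 * k \<le> m" using not_cops_win_lower by blast
  then show "m div 2 + 1 \<le> k" by simp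
qed

end

subsection \<open>Lucas cubes\<close>

definition support :: "bool list \<Rightarrow> nat set" where
  "support x = {i. i < length x \<and> x ! i}"

text \<open>For \<open>n \<ge> 2\<close> these are the independent sets of a cycle on
  \<open>{..<n}\<close>: the successor modulo \<open>n\<close> joins the last position to the
  first.\<close>

definition lucas_sets :: "nat \<Rightarrow> nat set set" where
  "lucas_sets n =
     {A. A \<subseteq> {..<n} \<and> (if n < 2 then A = {} else \<forall>i\<in>A. Suc i mod n \<notin> A)}"

lemma hypercube_adj_iff:
  "length x = length y \<Longrightarrow> hypercube_adj x y \<longleftrightarrow> cube_adj (support x) (support y)"
proof -
  assume "length x = length y"
  then have "sym_diff (support x) (support y) = {i. i < length x \<and> x ! i \<noteq> y ! i}"
    by (auto simp: support_def)
  then show ?thesis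
    using \<open>length x = length y\<close> by (simp add: hypercube_adj_def cube_adj_def)
qed

lemma length_lucas_vertices: "x \<in> lucas_vertices n \<Longrightarrow> length x = n"
  by (auto simp: lucas_vertices_def split: if_splits)

lemma support_in_lucas_sets_iff:
  assumes "length x = n"
  shows "support x \<in> lucas_sets n \<longleftrightarrow> x \<in> lucas_vertices n"
proof (cases "n < 2")
  case True
  with assms show ?thesis
    by (auto simp: lucas_sets_def lucas_vertices_def support_def list_eq_iff_nth_eq)
next
  case False
  have "(\<forall>i\<in>support x. Suc i mod n \<notin> support x) \<longleftrightarrow>
    (\<forall>i. i < n \<longrightarrow> \<not> (x ! i \<and> x ! (Suc i mod n)))"
    using assms False by (auto simp: support_def)
  also have "\<dots> \<longleftrightarrow> (\<forall>i. Suc i < n \<longrightarrow> \<not> (x ! i \<and> x ! Suc i)) \<and> \<not> (x ! 0 \<and> x ! (n - 1))"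
    (is "?L \<longleftrightarrow> ?R")
  proof
    assume ?L
    then have L: "\<not> (x ! i \<and> x ! (Suc i mod n))" if "i < n" for i using that by blast
    show ?R
    proof (intro conjI allI impI)
      show "\<not> (x ! i \<and> x ! Suc i)" if "Suc i < n" for i
        using L[of i] that by simp
      \<comment> \<open>The wrap-around pair is the instance \<open>i = n - 1\<close>.\<close>
      show "\<not> (x ! 0 \<and> x ! (n - 1))"
        using L[of "n - 1"] False by auto
    qed
  next
    assume R: ?R
    show ?L
    proof (intro allI impI)
      fix i assume "i < n"
      show "\<not> (x ! i \<and> x ! (Suc i mod n))"
      proof (cases "Suc i < n")
        case True
        with R show ?thesis by simp
      next
        case False
        then have "Suc i = n" using \<open>i < n\<close> by simp
        with R show ?thesis by auto
      qed
    qed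
  qed
  finally show ?thesis
    using assms False by (auto simp: lucas_sets_def lucas_vertices_def support_def)
qed

lemma bij_betw_support: "bij_betw support (lucas_vertices n) (lucas_sets n)"
proof (rule bij_betwI[where g = "\<lambda>A. map (\<lambda>i. i \<in> A) [0..<n]"])
  have inv: "support (map (\<lambda>i. i \<in> A) [0..<n]) = A" if "A \<in> lucas_sets n" for A
    using that by (auto simp: lucas_sets_def support_def)
  then show "support (map (\<lambda>i. i \<in> A) [0..<n]) = A" if "A \<in> lucas_sets n" for A
    using that .
  show "support \<in> lucas_vertices n \<rightarrow> lucas_sets n"
    using length_lucas_vertices support_in_lucas_sets_iff by blast
  show "(\<lambda>A. map (\<lambda>i. i \<in> A) [0..<n]) \<in> lucas_sets n \<rightarrow> lucas_vertices n"
    using inv by (auto simp flip: support_in_lucas_sets_iff)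
  show "map (\<lambda>i. i \<in> support x) [0..<n] = x" if "x \<in> lucas_vertices n" for x
    using length_lucas_vertices[OF that] by (auto simp: support_def list_eq_iff_nth_eq)
qed

lemma daisy_cube_lucas_sets: "daisy_cube (lucas_sets n) (n div 2)"
proof
  show "finite A" if "A \<in> lucas_sets n" for A
    using that finite_subset[of A "{..<n}"] by (auto simp: lucas_sets_def)
  show "B \<in> lucas_sets n" if "A \<in> lucas_sets n" "B \<subseteq> A" for A B
    using that by (auto simp: lucas_sets_def split: if_splits)
  show "card A \<le> n div 2" if A: "A \<in> lucas_sets n" for A
  proof (cases "n < 2")
    case True
    with A show ?thesis by (simp add: lucas_sets_def)
  next
    case False
    \<comment> \<open>\<open>A\<close> and its cyclic shift are disjoint and equally large, and both
      lie in \<open>{..<n}\<close>.\<close>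
    let ?next = "\<lambda>i. Suc i mod n"
    have sub: "A \<subseteq> {..<n}" and disj: "A \<inter> ?next ` A = {}"
      using A False by (auto simp: lucas_sets_def)
    then have fin: "finite A" using finite_subset by blast
    have "inj_on ?next A"
      by (rule inj_on_subset[OF _ sub]) (auto simp: inj_on_def mod_Suc split: if_splits)
    then have "card A + card A = card (A \<union> ?next ` A)"
      using fin disj by (simp add: card_Un_disjoint card_image)
    also have "\<dots> \<le> card {..<n}"
      using sub False by (intro card_mono) auto
    finally show ?thesis by simp
  qed
  \<comment> \<open>Alternate positions attain the bound. For odd \<open>n\<close> position
    \<open>n - 1\<close> is left out, so there is no conflict with position 0.\<close>
  have "(\<lambda>i. 2 * i) ` {..<n div 2} \<in> lucas_sets n"
  proof -
    have "Suc (2 * i) mod n \<noteq> 2 * j" if "i < n div 2" for i j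
    proof -
      have "Suc (2 * i) < n" using that by linarith
      then show ?thesis by (simp add: mod_less) presburger
    qed
    then show ?thesis by (auto simp: lucas_sets_def)
  qed
  moreover have "card ((\<lambda>i. 2 * i) ` {..<n div 2}) = n div 2"
    by (subst card_image) (auto simp: inj_on_def)
  ultimately show "\<exists>A\<in>lucas_sets n. card A = n div 2" by blast
qed

lemma lucas_cop_number_eq: "lucas_cop_number n = n div 4 + 1"
proof -
  have "lucas_cop_number n = cop_number (lucas_sets n) cube_adj"
    unfolding lucas_cop_number_def using bij_betw_support
    by (rule cop_number_transfer) (simp add: hypercube_adj_iff length_lucas_vertices)
  also have "\<dots> = n div 2 div 2 + 1"
    by (rule daisy_cube.cop_number_daisy_cube[OF daisy_cube_lucas_sets])
  finally show ?thesis by (simp flip: div_mult2_eq)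
qed

theorem theorem5p1:
  "(\<forall>n::nat.
      int (lucas_cop_number n) = \<lceil>(real_of_int \<lfloor>real n / 2\<rfloor> + 1) / 2\<rceil> \<and>
      \<lceil>(real_of_int \<lfloor>real n / 2\<rfloor> + 1) / 2\<rceil> = \<lfloor>real n / 4\<rfloor> + 1) \<and>
   (\<forall>q::nat.
      lucas_cop_number (4 * q) = q + 1 \<and>
      lucas_cop_number (4 * q + 1) = q + 1 \<and>
      lucas_cop_number (4 * q + 2) = q + 1 \<and>
      lucas_cop_number (4 * q + 3) = q + 1)"
proof -
  have floor2: "\<lfloor>real n / 2\<rfloor> = int (n div 2)" and floor4: "\<lfloor>real n / 4\<rfloor> = int (n div 4)" for n
    using floor_divide_of_nat_eq[of n 2] floor_divide_of_nat_eq[of n 4] by simp_all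
  have "\<lceil>(real_of_int \<lfloor>real n / 2\<rfloor> + 1) / 2\<rceil> = int (n div 4) + 1" for n
  proof (rule ceiling_unique)
    \<comment> \<open>Since \<open>n div 2\<close> is \<open>2 * (n div 4)\<close> or one more, half
      of its successor exceeds \<open>n div 4\<close> and is at most
      \<open>n div 4 + 1\<close>.\<close>
    have "2 * (n div 4) \<le> n div 2" "n div 2 \<le> 2 * (n div 4) + 1" by linarith+
    then have "2 * real (n div 4) \<le> real (n div 2)" "real (n div 2) \<le> 2 * real (n div 4) + 1"
      by linarith+
    then show "real_of_int (int (n div 4) + 1) - 1 < (real_of_int \<lfloor>real n / 2\<rfloor> + 1) / 2"
      "(real_of_int \<lfloor>real n / 2\<rfloor> + 1) / 2 \<le> real_of_int (int (n div 4) + 1)"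
      by (simp_all add: floor2)
  qed
  moreover have "(4 * q) div 4 = q \<and> (4 * q + 1) div 4 = q \<and> (4 * q + 2) div 4 = q \<and>
    (4 * q + 3) div 4 = q" for q :: nat
    by linarith
  ultimately show ?thesis unfolding lucas_cop_number_eq by (simp add: floor4)
qed

end
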